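(* Let $a$ and $c$ be positive integers and let $b$ and $d$ be any integers such that $ad\ne bc$. Then for any positive integer $k$, the set of positive integers $n$ for which \[ \phi\big(a(n+1)+b\big) > \phi\big(c(n+1)+d\big),\quad \phi\big(a(n+2)+b\big) > \phi\big(c(n+2)+d\big),\quad \dots,\quad \phi\big(a(n+k)+b\big) > \phi\big(c(n+k)+d\big) \] all hold has positive lower density.
   Context: $\phi$ denotes the Euler phi-function on positive integers. The lower density of a set $S$ of positive integers is $\liminf_{x\to\infty} \frac1x\#\{n\in S: n\le x\}$. Only those $n$ for which all arguments of $\phi$ are positive are considered; this excludes only finitely many $n$ and does not affect lower density. *)

theory Defs
  imports "HOL-Number_Theory.Totient" "HOL-Library.Extended_Real" "HOL-Library.Liminf_Limsup"
begin

text \<open>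
  The limit inferior is taken over real \<open>x\<close>, in the extended reals so that it always exists.
  The definition is meant for sets of positive integers.
\<close>

definition lower_density :: "nat set \<Rightarrow> ereal" where
  "lower_density S = Liminf at_top (\<lambda>x::real. ereal (real (card {n \<in> S. real n \<le> x}) / x))"

end

theory Submission
  imports Defs "HOL-Analysis.Harmonic_Numbers"
begin

text \<open>
  Put \<open>A\<^sub>i = a(n + i) + b\<close> and \<open>C\<^sub>i = c(n + i) + d\<close>, and let \<open>E(S)\<close> be the product of
  \<open>p / (p - 1)\<close> over the primes \<open>p \<in> S\<close>, so that \<open>N / \<phi>(N) = E(S)\<close> for the set \<open>S\<close> of prime
  factors of \<open>N\<close>. Since \<open>C\<^sub>i / A\<^sub>i\<close> is bounded, \<open>\<phi>(A\<^sub>i) > \<phi>(C\<^sub>i)\<close> follows once \<open>C\<^sub>i / \<phi>(C\<^sub>i)\<close>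
  exceeds \<open>A\<^sub>i / \<phi>(A\<^sub>i)\<close> by a large enough constant factor.

  By the Chinese remainder theorem, \<open>n\<close> can be confined to a progression modulo some \<open>Q\<close> on which
  each \<open>C\<^sub>i\<close> is divisible by all primes of a prescribed finite set \<open>V\<^sub>i\<close>; the \<open>V\<^sub>i\<close> are disjoint and
  consist of primes above a bound \<open>P\<close>. As \<open>E\<close> is unbounded (lemma \<open>euler_prod_unbounded\<close>), the
  \<open>E(V\<^sub>i)\<close> can be made as large as desired. The primes of the \<open>V\<^sub>j\<close> may also divide \<open>A\<^sub>i\<close>: if
  \<open>p \<in> V\<^sub>j\<close> divides \<open>A\<^sub>i\<close>, then it divides \<open>c A\<^sub>i - a C\<^sub>j = ac(i - j) + bc - ad\<close>, a number of size
  at most \<open>P\<close>, so that \<open>ac(i - j) = ad - bc\<close>. Hence \<open>i - j\<close> has the same sign as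
  \<open>ad - bc \<noteq> 0\<close>: with the indices listed in increasing order if \<open>ad > bc\<close> and in decreasing order
  otherwise, \<open>A\<^sub>i\<close> only meets sets \<open>V\<^sub>j\<close> with \<open>j\<close> before \<open>i\<close>. It therefore suffices to let
  \<open>E(V\<^sub>i)\<close> dominate the product of all earlier \<open>E(V\<^sub>j)\<close> (lemma \<open>euler_prod_chain\<close>).

  The remaining prime factors of \<open>A\<^sub>i\<close> are those up to \<open>P\<close>, whose contribution is bounded, and those
  above \<open>P\<close> that do not divide the modulus \<open>aQ\<close>. For the latter an averaging argument over the
  progression (lemma \<open>card_large_euler_prod_le\<close>) shows that their contribution exceeds \<open>exp 2\<close> for a
  proportion of at most \<open>2 / P\<close> of the terms. This bound and the constant \<open>exp 2\<close> do not depend on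
  \<open>Q\<close>, which is what allows the \<open>V\<^sub>i\<close> to be chosen afterwards. With \<open>P \<ge> 4k\<close> at least half of
  the progression satisfies all \<open>k\<close> inequalities.
\<close>

section \<open>Products over primes\<close>

text \<open>
  The product is used for sets of primes. For infinite \<open>S\<close> it has the default value \<open>1\<close>.
\<close>

definition euler_prod :: "nat set \<Rightarrow> real" where
  "euler_prod S = (\<Prod>p\<in>S. real p / (real p - 1))"

lemma euler_factor_ge_1:
  assumes "prime (p::nat)"
  shows "real p / (real p - 1) \<ge> 1"
  using prime_gt_1_nat[OF assms] by (simp add: field_simps)

lemma euler_prod_ge_1:
  assumes "\<And>p. p \<in> S \<Longrightarrow> prime p"
  shows "euler_prod S \<ge> 1"
  unfolding euler_prod_def by (intro prod_ge_1 euler_factor_ge_1 assms)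

lemma euler_prod_pos:
  assumes "\<And>p. p \<in> S \<Longrightarrow> prime p"
  shows "euler_prod S > 0"
  by (rule less_le_trans[OF zero_less_one euler_prod_ge_1[OF assms]])

lemma euler_prod_mono:
  assumes "finite T" "S \<subseteq> T" "\<And>p. p \<in> T \<Longrightarrow> prime p"
  shows "euler_prod S \<le> euler_prod T"
  unfolding euler_prod_def
proof (rule prod_mono2)
  fix p
  show "0 \<le> real p / (real p - 1)" if "p \<in> S"
    using order_trans[OF zero_le_one euler_factor_ge_1] that assms(2,3) by blast
  show "1 \<le> real p / (real p - 1)" if "p \<in> T - S"
    using euler_factor_ge_1 that assms(3) by blast
qed (use assms in blast)+

lemma euler_prod_Un_disjoint:
  assumes "finite S" "finite T" "S \<inter> T = {}"
  shows "euler_prod (S \<union> T) = euler_prod S * euler_prod T"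
  unfolding euler_prod_def using assms by (rule prod.union_disjoint)

lemma euler_prod_Un_le:
  assumes "finite S" "finite T" "\<And>p. p \<in> S \<union> T \<Longrightarrow> prime p"
  shows "euler_prod (S \<union> T) \<le> euler_prod S * euler_prod T"
proof -
  have "euler_prod (S \<union> T) = euler_prod S * euler_prod (T - S)"
    using euler_prod_Un_disjoint[of S "T - S"] assms by (simp add: Un_Diff_cancel)
  also have "\<dots> \<le> euler_prod S * euler_prod T"
    using assms by (intro mult_left_mono euler_prod_mono less_imp_le[OF euler_prod_pos]) auto
  finally show ?thesis .
qed

lemma euler_prod_le_exp:
  assumes "\<And>p. p \<in> S \<Longrightarrow> prime p"
  shows "euler_prod S \<le> exp (\<Sum>p\<in>S. 1 / (real p - 1))"
proof (cases "finite S")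
  case True
  have "euler_prod S \<le> (\<Prod>p\<in>S. exp (1 / (real p - 1)))"
    unfolding euler_prod_def
  proof (intro prod_mono conjI)
    fix p assume "p \<in> S"
    then have p: "prime p" "real p > 1"
      using assms prime_gt_1_nat[of p] by auto
    show "0 \<le> real p / (real p - 1)"
      using euler_factor_ge_1[OF p(1)] by linarith
    have "real p / (real p - 1) = 1 + 1 / (real p - 1)"
      using p(2) by (simp add: field_simps)
    then show "real p / (real p - 1) \<le> exp (1 / (real p - 1))"
      using exp_ge_add_one_self[of "1 / (real p - 1)"] by simp
  qed
  also have "\<dots> = exp (\<Sum>p\<in>S. 1 / (real p - 1))"
    using True by (simp add: exp_sum)
  finally show ?thesis .
qed (simp add: euler_prod_def)

lemma totient_mult_euler_prod:
  "real (totient n) * euler_prod (prime_factors n) = real n"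
proof -
  have "(\<Prod>p\<in>prime_factors n. 1 - 1 / real p) * euler_prod (prime_factors n)
      = (\<Prod>p\<in>prime_factors n. (1 - 1 / real p) * (real p / (real p - 1)))"
    unfolding euler_prod_def by (rule prod.distrib[symmetric])
  also have "\<dots> = 1"
  proof (rule prod.neutral, intro ballI)
    fix p assume "p \<in> prime_factors n"
    then have "real p > 1"
      using prime_gt_1_nat[of p] by (auto dest: in_prime_factors_imp_prime)
    then show "(1 - 1 / real p) * (real p / (real p - 1)) = 1"
      by (simp add: field_simps)
  qed
  finally show ?thesis
    by (simp add: totient_formula2 mult.assoc)
qed

section \<open>Divergence of the product over the primes\<close>

text \<open>
  One half of Euler's product formula. For the induction step, let \<open>h\<close> and \<open>h'\<close> be the sums for
  \<open>S\<close> and \<open>insert p S\<close>. The terms of \<open>h'\<close> that are divisible by \<open>p\<close> contribute at most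
  \<open>h' / p\<close>, so \<open>h' \<le> h + h' / p\<close>, that is, \<open>h' \<le> p / (p - 1) * h\<close>.
\<close>

lemma sum_smooth_le_euler_prod:
  assumes "finite S" "\<And>p. p \<in> S \<Longrightarrow> prime p"
  shows "(\<Sum>n | n \<in> {1..N} \<and> prime_factors n \<subseteq> S. 1 / real n) \<le> euler_prod S"
  using assms
proof (induction S rule: finite_induct)
  case empty
  have "{n. n \<in> {1..N} \<and> prime_factors n \<subseteq> {}} \<subseteq> {1::nat}"
    by (auto simp: prime_factorization_empty_iff)
  then have "(\<Sum>n | n \<in> {1..N} \<and> prime_factors n \<subseteq> {}. 1 / real n) \<le> (\<Sum>n\<in>{1::nat}. 1 / real n)"
    by (intro sum_mono2) auto
  then show ?case
    by (simp add: euler_prod_def)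
next
  case (insert p S)
  let ?F = "{n. n \<in> {1..N} \<and> prime_factors n \<subseteq> S}"
  let ?G = "{n. n \<in> {1..N} \<and> prime_factors n \<subseteq> insert p S}"
  let ?h = "\<lambda>A. \<Sum>n\<in>A. 1 / real n"
  have p: "prime p" "real p > 1"
    using insert.prems prime_gt_1_nat[of p] by auto
  have fin: "finite ?F" "finite ?G"
    by auto
  have "?G \<subseteq> ?F \<union> (\<lambda>n. p * n) ` ?G"
  proof
    fix n assume n: "n \<in> ?G"
    show "n \<in> ?F \<union> (\<lambda>n. p * n) ` ?G"
    proof (cases "p dvd n")
      case True
      then obtain m where m: "n = p * m" ..
      then have "m \<noteq> 0" "p \<noteq> 0"
        using n by auto
      then have "m \<le> n" "prime_factors m \<subseteq> prime_factors n"
        using m by (auto simp: prime_factorization_mult)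
      then have "m \<in> ?G"
        using n \<open>m \<noteq> 0\<close> by auto
      then show ?thesis
        using m by auto
    next
      case False
      then have "p \<notin> prime_factors n"
        by auto
      then show ?thesis
        using n by auto
    qed
  qed
  then have "?h ?G \<le> ?h (?F \<union> (\<lambda>n. p * n) ` ?G)"
    by (intro sum_mono2) (use fin in auto)
  also have "\<dots> \<le> ?h ?F + ?h ((\<lambda>n. p * n) ` ?G)"
    using fin by (simp add: sum_Un sum_nonneg)
  also have "?h ((\<lambda>n. p * n) ` ?G) = ?h ?G / real p"
    using p by (subst sum.reindex) (auto simp: inj_on_def sum_divide_distrib field_simps)
  also have "?h ?F \<le> euler_prod S"
    using insert by auto
  finally have "?h ?G \<le> euler_prod S + ?h ?G / real p"
    by simp
  then have "?h ?G \<le> real p / (real p - 1) * euler_prod S"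
    using p(2) by (simp add: field_simps)
  also have "\<dots> = euler_prod (insert p S)"
    using insert.hyps by (simp add: euler_prod_def)
  finally show ?case .
qed

text \<open>
  Every \<open>n \<le> N\<close> has only prime factors up to \<open>N\<close>, so the product over the primes up to \<open>N\<close> is at
  least the harmonic number of \<open>N\<close>; omitting the primes in \<open>W\<close> costs only a constant factor.
\<close>

lemma euler_prod_unbounded:
  fixes W :: "nat set" and B :: real
  assumes "finite W"
  obtains S where "finite S" "\<And>p. p \<in> S \<Longrightarrow> prime p" "S \<inter> W = {}" "B < euler_prod S"
proof -
  define V where "V = {p \<in> W. prime p}"
  have V: "finite V" "\<And>p. p \<in> V \<Longrightarrow> prime p"
    using assms by (auto simp: V_def)
  have "eventually (\<lambda>N. harm N > B * euler_prod V) sequentially"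
    using harm_at_top by (simp add: filterlim_at_top_dense)
  then obtain N where N: "harm N > B * euler_prod V"
    by (auto simp: eventually_sequentially)
  define T where "T = {p. prime p \<and> p \<le> N}"
  have T: "finite T" "\<And>p. p \<in> T \<Longrightarrow> prime p"
    by (auto simp: T_def)
  have "{n. n \<in> {1..N} \<and> prime_factors n \<subseteq> T} = {1..N}"
    by (force simp: T_def dest: dvd_imp_le)
  then have "harm N = (\<Sum>n | n \<in> {1..N} \<and> prime_factors n \<subseteq> T. 1 / real n)"
    by (simp add: harm_def inverse_eq_divide)
  also have "\<dots> \<le> euler_prod T"
    using T by (intro sum_smooth_le_euler_prod)
  also have "\<dots> \<le> euler_prod ((T - W) \<union> V)"
    by (rule euler_prod_mono) (use T(1) V(1) in \<open>auto simp: T_def V_def\<close>)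
  also have "\<dots> \<le> euler_prod (T - W) * euler_prod V"
    using T V by (intro euler_prod_Un_le) auto
  finally have "B * euler_prod V < euler_prod (T - W) * euler_prod V"
    using N by simp
  then have "B < euler_prod (T - W)"
    using euler_prod_pos[of V] V by (simp add: mult_less_cancel_right)
  then show ?thesis
    using that[of "T - W"] T by auto
qed

text \<open>
  The differences \<open>U (Suc i) - U i\<close> are the successive disjoint sets of primes, each outweighing all
  of its predecessors together by the factor \<open>D\<close>.
\<close>

lemma euler_prod_chain:
  fixes W :: "nat set" and D :: real
  assumes "finite W"
  obtains U :: "nat \<Rightarrow> nat set" where
    "\<And>i. finite (U i)" "\<And>i p. p \<in> U i \<Longrightarrow> prime p" "\<And>i. U i \<inter> W = {}"
    "U 0 = {}" "mono U" "\<And>i. D * euler_prod (U i) < euler_prod (U (Suc i) - U i)"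
proof -
  let ?P = "\<lambda>i V. finite V \<and> (\<forall>p\<in>V. prime (p::nat)) \<and> V \<inter> W = {} \<and> (i = (0::nat) \<longrightarrow> V = {})"
  let ?Q = "\<lambda>(i::nat) V V'. V \<subseteq> V' \<and> D * euler_prod V < euler_prod (V' - V)"
  have "\<exists>U. \<forall>i. ?P i (U i) \<and> ?Q i (U i) (U (Suc i))"
  proof (rule dependent_nat_choice)
    show "\<exists>V. ?P 0 V"
      by auto
  next
    fix V i assume V: "?P i V"
    obtain S where S: "finite S" "\<And>p. p \<in> S \<Longrightarrow> prime p" "S \<inter> (V \<union> W) = {}"
        "D * euler_prod V < euler_prod S"
      using euler_prod_unbounded[of "V \<union> W"] V assms by (metis finite_Un)
    then have "(V \<union> S) - V = S"
      by auto
    then have "?P (Suc i) (V \<union> S) \<and> ?Q i V (V \<union> S)"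
      using V S by auto
    then show "\<exists>V'. ?P (Suc i) V' \<and> ?Q i V V'"
      by blast
  qed
  then obtain U where U: "\<forall>i. ?P i (U i) \<and> ?Q i (U i) (U (Suc i))"
    by (rule exE)
  then have "mono U"
    by (simp add: mono_iff_le_Suc)
  show ?thesis
  proof (rule that[of U])
    show "prime p" if "p \<in> U i" for i p
      using U that by blast
  qed (use U \<open>mono U\<close> in simp_all)
qed

section \<open>Prime divisors of the terms of an arithmetic progression\<close>

lemma card_dvd_progression_le:
  fixes \<alpha> \<beta> X p :: nat
  assumes "prime p" "\<not> p dvd \<alpha>" "p \<le> X"
  shows "real (card {m \<in> {1..X}. p dvd \<alpha> * m + \<beta>}) \<le> 2 * real X / real p"
proof -
  let ?A = "{m \<in> {1..X}. p dvd \<alpha> * m + \<beta>}"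
  have p0: "p > 0"
    using assms(1) by (simp add: prime_gt_0_nat)
  have cop: "coprime \<alpha> p"
    using prime_imp_coprime[OF assms(1,2)] by (simp add: coprime_commute)
  have "inj_on (\<lambda>m. m div p) ?A"
  proof (rule inj_onI)
    fix m m' assume m: "m \<in> ?A" "m' \<in> ?A" and eq: "m div p = m' div p"
    have "[\<alpha> * m + \<beta> = \<alpha> * m' + \<beta>] (mod p)"
      using m by (simp add: cong_def)
    then have "[m = m'] (mod p)"
      using cop by (simp add: cong_add_rcancel_nat cong_mult_lcancel_nat)
    then show "m = m'"
      using eq by (metis cong_def div_mult_mod_eq)
  qed
  then have "card ?A \<le> card {0..X div p}"
    by (rule card_inj_on_le) (auto intro: div_le_mono)
  then have "real (card ?A) \<le> real (X div p) + 1"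
    by simp
  also have "real (X div p) \<le> real X / real p"
    by (rule of_nat_div_le_of_nat)
  also have "1 \<le> real X / real p"
    using assms p0 by (simp add: field_simps)
  finally show ?thesis
    by simp
qed

lemma sum_inverse_mult_pred_le:
  fixes P X :: nat
  assumes "P \<ge> 1"
  shows "(\<Sum>p\<in>{P<..X}. 1 / (real p * (real p - 1))) \<le> 1 / real P"
proof (cases "P \<le> X")
  case True
  have "(\<Sum>p\<in>{P<..X}. 1 / (real p * (real p - 1))) \<le> 1 / real P - 1 / real X"
    using True
  proof (induction X rule: dec_induct)
    case base
    then show ?case by simp
  next
    case (step n)
    have "{P<..Suc n} = insert (Suc n) {P<..n}"
      using step by auto
    moreover have "1 / (real (Suc n) * (real (Suc n) - 1)) = 1 / real n - 1 / real (Suc n)"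
      using step assms by (simp add: field_simps)
    ultimately show ?case
      using step.IH by simp
  qed
  then show ?thesis
    by (smt (verit) divide_nonneg_nonneg of_nat_0_le_iff)
qed simp

text \<open>
  The sum of \<open>1 / (p - 1)\<close> over the relevant primes dividing \<open>\<alpha> * m + \<beta>\<close> is at most
  \<open>2 / P\<close> on average over \<open>m\<close>, and Markov's inequality applies. Restricting to \<open>p \<le> X\<close> is what
  lets \<open>2 * X / p\<close> bound the number of \<open>m\<close> with \<open>p\<close> dividing \<open>\<alpha> * m + \<beta>\<close>, and skipping the primes
  that divide \<open>\<alpha>\<close> makes the bound independent of the progression.
\<close>

lemma card_many_small_primes_le:
  fixes \<alpha> \<beta> P X :: nat
  assumes "P \<ge> 1"
  shows "real (card {m \<in> {1..X}. 1 <
           (\<Sum>p | prime p \<and> p \<in> {P<..X} \<and> \<not> p dvd \<alpha> \<and> p dvd \<alpha> * m + \<beta>. 1 / (real p - 1))})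
         \<le> 2 * real X / real P"
proof -
  let ?T = "{p. prime p \<and> p \<in> {P<..X} \<and> \<not> p dvd \<alpha>}"
  let ?S = "\<lambda>m. {p. prime p \<and> p \<in> {P<..X} \<and> \<not> p dvd \<alpha> \<and> p dvd \<alpha> * m + \<beta>}"
  let ?f = "\<lambda>m. \<Sum>p\<in>?S m. 1 / (real p - 1)"
  let ?B = "{m \<in> {1..X}. 1 < ?f m}"
  have finT: "finite ?T"
    by (rule finite_subset[of _ "{P<..X}"]) auto
  have nonneg: "0 \<le> ?f m" for m
    using assms by (intro sum_nonneg) auto
  have "real (card ?B) = (\<Sum>m\<in>?B. 1)"
    by simp
  also have "\<dots> \<le> (\<Sum>m\<in>?B. ?f m)"
    by (intro sum_mono) auto
  also have "\<dots> \<le> (\<Sum>m\<in>{1..X}. ?f m)"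
    using nonneg by (intro sum_mono2) auto
  also have "\<dots> = (\<Sum>m\<in>{1..X}. \<Sum>p | p \<in> ?T \<and> p dvd \<alpha> * m + \<beta>. 1 / (real p - 1))"
    by (simp add: conj_assoc)
  also have "\<dots> = (\<Sum>p\<in>?T. \<Sum>m | m \<in> {1..X} \<and> p dvd \<alpha> * m + \<beta>. 1 / (real p - 1))"
    by (rule sum.swap_restrict) (use finT in auto)
  also have "\<dots> = (\<Sum>p\<in>?T. real (card {m \<in> {1..X}. p dvd \<alpha> * m + \<beta>}) / (real p - 1))"
    by simp
  also have "\<dots> \<le> (\<Sum>p\<in>?T. (2 * real X / real p) / (real p - 1))"
    using assms by (intro sum_mono divide_right_mono card_dvd_progression_le) auto
  also have "\<dots> = 2 * real X * (\<Sum>p\<in>?T. 1 / (real p * (real p - 1)))"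
    by (simp add: sum_distrib_left)
  also have "\<dots> \<le> 2 * real X * (\<Sum>p\<in>{P<..X}. 1 / (real p * (real p - 1)))"
    using assms by (intro mult_left_mono sum_mono2) auto
  also have "\<dots> \<le> 2 * real X * (1 / real P)"
    using assms by (intro mult_left_mono sum_inverse_mult_pred_le) auto
  finally show ?thesis
    by simp
qed

text \<open>A number below \<open>X ^ 3\<close> has at most two prime factors exceeding \<open>X\<close>.\<close>

lemma sum_large_prime_factors_le:
  fixes N X :: nat
  assumes "N > 0" "X \<ge> 2" "N < X ^ 3"
  shows "(\<Sum>p | p \<in> prime_factors N \<and> X < p. 1 / (real p - 1)) \<le> 1"
proof -
  let ?L = "{p. p \<in> prime_factors N \<and> X < p}"
  have fin: "finite ?L"
    by auto
  have "X ^ card ?L = (\<Prod>p\<in>?L. X)"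
    by simp
  also have "\<dots> \<le> (\<Prod>p\<in>?L. p)"
    by (intro prod_mono) auto
  also have "\<dots> \<le> N"
  proof -
    have "(\<Prod>p\<in>?L. p) dvd (\<Prod>p\<in>prime_factors N. p)"
      by (intro prod_dvd_prod_subset) auto
    also have "(\<Prod>p\<in>prime_factors N. p) dvd (\<Prod>p\<in>prime_factors N. p ^ multiplicity p N)"
      by (intro prod_dvd_prod) (auto simp: prime_factors_multiplicity)
    also have "\<dots> = N"
      using assms(1) by (rule prime_factorization_nat[symmetric])
    finally show ?thesis
      using assms(1) by (intro dvd_imp_le)
  qed
  also have "N < X ^ 3"
    by fact
  finally have "card ?L < 3"
    using assms(2) by (simp add: power_strict_increasing_iff)
  have "(\<Sum>p\<in>?L. 1 / (real p - 1)) \<le> (\<Sum>p\<in>?L. 1 / real X)"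
    using assms by (intro sum_mono divide_left_mono) auto
  also have "\<dots> = real (card ?L) / real X"
    by simp
  also have "\<dots> \<le> 1"
    using \<open>card ?L < 3\<close> assms(2) by simp
  finally show ?thesis .
qed

text \<open>
  In terms of \<open>exp (\<Sum>p. 1 / (p - 1))\<close>, the primes up to \<open>X\<close> contribute at most \<open>exp 1\<close> for all but
  few \<open>m\<close>, and the primes above \<open>X\<close> at most another \<open>exp 1\<close> for every \<open>m\<close>.
\<close>

lemma card_large_euler_prod_le:
  fixes \<alpha> \<beta> P X :: nat
  assumes "P \<ge> 1" "\<beta> > 0" "X \<ge> 2" "X > \<alpha> + \<beta>"
  shows "real (card {m \<in> {1..X}. exp 2 <
           euler_prod {p \<in> prime_factors (\<alpha> * m + \<beta>). P < p \<and> \<not> p dvd \<alpha>}})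
         \<le> 2 * real X / real P"
proof -
  let ?E = "\<lambda>m. {p \<in> prime_factors (\<alpha> * m + \<beta>). P < p \<and> \<not> p dvd \<alpha>}"
  let ?S = "\<lambda>m. {p. prime p \<and> p \<in> {P<..X} \<and> \<not> p dvd \<alpha> \<and> p dvd \<alpha> * m + \<beta>}"
  let ?L = "\<lambda>m. {p. p \<in> prime_factors (\<alpha> * m + \<beta>) \<and> X < p}"
  let ?w = "\<lambda>p. 1 / (real p - 1)"
  have "{m \<in> {1..X}. exp 2 < euler_prod (?E m)} \<subseteq> {m \<in> {1..X}. 1 < sum ?w (?S m)}"
  proof safe
    fix m assume m: "m \<in> {1..X}" and large: "exp 2 < euler_prod (?E m)"
    have finS: "finite (?S m)"
      by (rule finite_subset[of _ "{P<..X}"]) auto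
    have finL: "finite (?L m)"
      by auto
    have "\<alpha> * m + \<beta> \<le> (\<alpha> + \<beta>) * X"
      using m assms by (simp add: add_mult_distrib add_mono)
    also have "\<dots> < X * X"
      using assms by (intro mult_strict_right_mono) auto
    also have "\<dots> \<le> X ^ 3"
      using assms by (simp add: power3_eq_cube)
    finally have small: "\<alpha> * m + \<beta> < X ^ 3" .
    have "exp 2 < exp (sum ?w (?E m))"
      using large by (rule less_le_trans) (auto intro: euler_prod_le_exp)
    then have "2 < sum ?w (?E m)"
      by simp
    also have "sum ?w (?E m) \<le> sum ?w (?S m \<union> ?L m)"
      using finS finL assms by (intro sum_mono2) (auto simp: not_le)
    also have "\<dots> = sum ?w (?S m) + sum ?w (?L m)"
      using finS finL by (intro sum.union_disjoint) auto
    also have "sum ?w (?L m) \<le> 1"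
      using assms small by (intro sum_large_prime_factors_le) auto
    finally show "1 < sum ?w (?S m)"
      by simp
  qed
  then have "card {m \<in> {1..X}. exp 2 < euler_prod (?E m)} \<le> card {m \<in> {1..X}. 1 < sum ?w (?S m)}"
    by (intro card_mono) auto
  also have "real \<dots> \<le> 2 * real X / real P"
    using assms(1) by (rule card_many_small_primes_le)
  finally show ?thesis
    by simp
qed

section \<open>Lower density and progressions\<close>

lemma lower_density_pos_of_progression:
  fixes S :: "nat set" and n0 Q X0 :: nat
  assumes "Q > 0"
    and dense: "\<And>X. X \<ge> X0 \<Longrightarrow> real X / 2 \<le> real (card {m \<in> {1..X}. n0 + Q * m \<in> S})"
  shows "lower_density S > 0"
proof -
  define e where "e = 1 / (4 * real Q)"
  have "e > 0"
    using assms(1) by (simp add: e_def)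
  \<comment> \<open>Large enough for \<open>X\<close> below to satisfy both \<open>X \<ge> X0\<close> and \<open>X \<ge> x / (2 * Q)\<close>.\<close>
  define x0 where "x0 = 3 * real n0 + 2 * real Q + real Q * (real X0 + 1)"
  have bound: "e \<le> real (card {n \<in> S. real n \<le> x}) / x" if "x \<ge> x0" "x > 0" for x :: real
  proof -
    have x: "x \<ge> 3 * real n0 + 2 * real Q + real Q * (real X0 + 1)" "x > 0"
      using that by (simp_all add: x0_def)
    define X where "X = nat \<lfloor>(x - real n0) / real Q\<rfloor>"
    have Q: "real Q > 0"
      using assms(1) by simp
    have xQ: "real X0 + 1 \<le> (x - real n0) / real Q"
      using x Q by (simp add: field_simps)
    have X: "real X \<le> (x - real n0) / real Q" "(x - real n0) / real Q - 1 < real X"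
      unfolding X_def using xQ by linarith+
    have "X0 \<le> X"
      using X(2) xQ by linarith
    have "(\<lambda>m. n0 + Q * m) ` {m \<in> {1..X}. n0 + Q * m \<in> S} \<subseteq> {n \<in> S. real n \<le> x}"
    proof safe
      fix m assume "m \<in> {1..X}"
      then have "real m \<le> (x - real n0) / real Q"
        using X(1) by (simp add: order_trans[of _ "real X"])
      then show "real (n0 + Q * m) \<le> x"
        using Q by (simp add: field_simps)
    qed
    moreover have "finite {n \<in> S. real n \<le> x}"
      by (rule finite_subset[of _ "{..nat \<lfloor>x\<rfloor>}"]) (auto simp: le_nat_floor)
    ultimately have "card ((\<lambda>m. n0 + Q * m) ` {m \<in> {1..X}. n0 + Q * m \<in> S}) \<le> card {n \<in> S. real n \<le> x}"
      by (intro card_mono)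
    moreover have "inj_on (\<lambda>m. n0 + Q * m) {m \<in> {1..X}. n0 + Q * m \<in> S}"
      using assms(1) by (auto simp: inj_on_def)
    ultimately have "card {m \<in> {1..X}. n0 + Q * m \<in> S} \<le> card {n \<in> S. real n \<le> x}"
      by (simp add: card_image)
    then have "real X / 2 \<le> real (card {n \<in> S. real n \<le> x})"
      using dense[OF \<open>X0 \<le> X\<close>] by linarith
    moreover have "e * x \<le> real X / 2"
    proof -
      have "0 \<le> real Q * (real X0 + 1)" "real n0 \<ge> 0"
        by auto
      then have "x \<ge> 2 * real n0 + 2 * real Q"
        using x(1) by linarith
      then have "x / (2 * real Q) \<le> (x - real n0) / real Q - 1"
        using Q by (simp add: field_simps)
      then have "x / (2 * real Q) \<le> real X"
        using X(2) by linarith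
      then show ?thesis
        by (simp add: e_def)
    qed
    ultimately have "e * x \<le> real (card {n \<in> S. real n \<le> x})"
      by linarith
    then show ?thesis
      using x(2) by (simp add: field_simps)
  qed
  have "eventually (\<lambda>x. ereal e \<le> ereal (real (card {n \<in> S. real n \<le> x}) / x)) at_top"
    using eventually_ge_at_top[of x0] eventually_gt_at_top[of "0::real"]
    by eventually_elim (use bound in simp)
  then have "ereal e \<le> lower_density S"
    unfolding lower_density_def by (rule Liminf_bounded)
  then show ?thesis
    using \<open>e > 0\<close> by (metis ereal_less(2) less_le_trans)
qed

section \<open>Comparison of the two linear forms\<close>

text \<open>
  For each prime \<open>p \<in> V i\<close> the divisibility fixes a residue of \<open>n0\<close> modulo \<open>p\<close>, because \<open>p\<close> does not
  divide \<open>c\<close>. The Chinese remainder theorem is applied to the pairs \<open>(i, p)\<close>.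
\<close>

lemma progression_dividing_forms:
  fixes c d :: int and I :: "'i set" and s :: "'i \<Rightarrow> nat" and V :: "'i \<Rightarrow> nat set" and L :: nat
  assumes "finite I" "\<And>i. i \<in> I \<Longrightarrow> finite (V i)"
    and "\<And>i p. i \<in> I \<Longrightarrow> p \<in> V i \<Longrightarrow> prime p \<and> \<not> int p dvd c"
    and "\<And>i j. i \<in> I \<Longrightarrow> j \<in> I \<Longrightarrow> i \<noteq> j \<Longrightarrow> V i \<inter> V j = {}"
  obtains n0 where "n0 \<ge> L"
    "\<And>i p. i \<in> I \<Longrightarrow> p \<in> V i \<Longrightarrow> int p dvd c * (int n0 + int (s i)) + d"
proof -
  let ?A = "Sigma I V"
  have "\<exists>u. int p dvd c * (int u + int (s i)) + d" if "(i, p) \<in> ?A" for i p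
  proof -
    have p: "prime p" "\<not> int p dvd c"
      using assms(3) that by auto
    then have "coprime c (int p)"
      using prime_imp_coprime[of "int p" c] by (simp add: coprime_commute)
    then obtain y where y: "[c * y = 1] (mod int p)"
      using cong_solve_coprime_int by blast
    define u where "u = nat ((- d * y - int (s i)) mod int p)"
    have "int u = (- d * y - int (s i)) mod int p"
      using prime_gt_0_nat[OF p(1)] by (simp add: u_def)
    then have "[int u = - d * y - int (s i)] (mod int p)"
      by (simp add: cong_def)
    then have "[c * (int u + int (s i)) + d = c * ((- d * y - int (s i)) + int (s i)) + d] (mod int p)"
      by (intro cong_add cong_mult cong_refl)
    also have "c * ((- d * y - int (s i)) + int (s i)) + d = - d * (c * y) + d"
      by (simp add: algebra_simps)
    also have "[- d * (c * y) + d = - d * 1 + d] (mod int p)"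
      using y by (intro cong_add cong_mult cong_refl)
    finally have "[c * (int u + int (s i)) + d = 0] (mod int p)"
      by simp
    then show ?thesis
      by (auto simp: cong_0_iff)
  qed
  then obtain u where u: "\<And>i p. (i, p) \<in> ?A \<Longrightarrow> int p dvd c * (int (u (i, p)) + int (s i)) + d"
    by (metis (no_types, lifting) case_prod_conv)
  have "\<forall>x\<in>?A. \<forall>y\<in>?A. x \<noteq> y \<longrightarrow> coprime (snd x) (snd y)"
  proof (intro ballI impI)
    fix x y assume xy: "x \<in> ?A" "y \<in> ?A" "x \<noteq> y"
    have "snd x \<noteq> snd y"
      using xy assms(4) by (cases x; cases y) auto
    moreover have "prime (snd x)" "prime (snd y)"
      using xy assms(3) by auto
    ultimately show "coprime (snd x) (snd y)"
      by (simp add: primes_coprime)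
  qed
  moreover have "finite ?A"
    using assms by auto
  ultimately obtain x0 where x0: "\<forall>x\<in>?A. [x0 = u x] (mod snd x)"
    using chinese_remainder_nat[of ?A snd u] by blast
  define Q where "Q = (\<Prod>x\<in>?A. snd x)"
  have "Q > 0"
    unfolding Q_def using assms(3) by (intro prod_pos) (auto simp: prime_gt_0_nat)
  show ?thesis
  proof (rule that[of "x0 + Q * L"])
    show "L \<le> x0 + Q * L"
      using \<open>Q > 0\<close> by (simp add: trans_le_add2)
    fix i p assume ip: "i \<in> I" "p \<in> V i"
    then have A: "(i, p) \<in> ?A"
      by auto
    then have "p dvd Q"
      unfolding Q_def using \<open>finite ?A\<close> dvd_prodI[of ?A "(i, p)" snd] by simp
    then have "[x0 + Q * L = u (i, p) + 0] (mod p)"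
      using x0 A by (intro cong_add) (auto simp: cong_0_iff)
    then have "[int (x0 + Q * L) = int (u (i, p))] (mod int p)"
      by (simp only: cong_int_iff add_0_right)
    then have "[c * (int (x0 + Q * L) + int (s i)) + d = c * (int (u (i, p)) + int (s i)) + d] (mod int p)"
      by (intro cong_add cong_mult cong_refl)
    then show "int p dvd c * (int (x0 + Q * L) + int (s i)) + d"
      using u[OF A] by (simp add: cong_dvd_iff)
  qed
qed

lemma totient_less_of_euler_prod_bounds:
  fixes A C :: nat and B E R :: real
  assumes "A > 0" "C > 0" "real C \<le> B * real A"
    and "euler_prod (prime_factors A) \<le> E"
    and "R \<le> euler_prod (prime_factors C)" "B * E < R"
  shows "totient C < totient A"
proof -
  have tA: "real (totient A) > 0" and tC: "real (totient C) > 0"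
    using assms by auto
  have B: "B > 0"
    using assms by (smt (verit) mult_nonpos_nonneg of_nat_0_less_iff)
  have "real (totient C) * R \<le> real (totient C) * euler_prod (prime_factors C)"
    using assms by (intro mult_left_mono) auto
  also have "\<dots> = real C"
    by (rule totient_mult_euler_prod)
  also have "\<dots> \<le> B * real A"
    by fact
  also have "\<dots> = B * (real (totient A) * euler_prod (prime_factors A))"
    by (simp add: totient_mult_euler_prod)
  also have "\<dots> \<le> B * (real (totient A) * E)"
    using assms B by (intro mult_left_mono) auto
  also have "\<dots> = real (totient A) * (B * E)"
    by simp
  also have "\<dots> < real (totient A) * R"
    using assms tA by (intro mult_strict_left_mono) auto
  finally have "real (totient C) * R < real (totient A) * R" .
  moreover have "R > 0"
  proof -
    have "euler_prod (prime_factors A) > 0"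
      by (intro euler_prod_pos) auto
    then have "B * E > 0"
      using B assms by simp
    then show ?thesis
      using assms by linarith
  qed
  ultimately show ?thesis
    by simp
qed

theorem corollary3:
  fixes a b c d :: int and k :: nat
  assumes "a > 0" and "c > 0" and "a * d \<noteq> b * c" and "k > 0"
  shows "lower_density
           {n :: nat. n > 0 \<and>
              (\<forall>i\<in>{1..k}. a * (int n + int i) + b > 0 \<and> c * (int n + int i) + d > 0 \<and>
                 totient (nat (a * (int n + int i) + b)) > totient (nat (c * (int n + int i) + d)))} > 0"
    (is "lower_density ?S > 0")
proof -
  \<comment> \<open>Primes above \<open>P\<close> divide neither \<open>a\<close> nor \<open>c\<close> nor a nonzero \<open>a * c * (i - j) + b * c - a * d\<close>;
    the summand \<open>4 * k\<close> keeps the total proportion of bad terms at most one half.\<close>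
  define P :: nat where "P = nat (a + c + a * c * int k + \<bar>b * c - a * d\<bar>) + 4 * k"
  define W where "W = {p::nat. prime p \<and> p \<le> P}"
  \<comment> \<open>A bound for the quotient of the two forms at all arguments from \<open>L\<close> (below) on.\<close>
  define B :: real where "B = 2 * real_of_int (c + \<bar>d\<bar>)"
  define D where "D = B * (euler_prod W * exp 2)"
  \<comment> \<open>Position of the index \<open>i\<close>, from \<open>0\<close> to \<open>k - 1\<close>, in the order in which the sets of primes grow.\<close>
  define \<rho> where "\<rho> = (\<lambda>i. if a * d > b * c then i - 1 else k - i)"

  have P: "int P \<ge> a" "int P \<ge> c" "int P \<ge> a * c * int k + \<bar>b * c - a * d\<bar>" "P \<ge> 4 * k" "P \<ge> 1"
    using assms by (auto simp: P_def)
  have W: "finite W" "\<And>p. p \<in> W \<Longrightarrow> prime p"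
    by (auto simp: W_def)
  obtain U where U: "\<And>i. finite (U i)" "\<And>i p. p \<in> U i \<Longrightarrow> prime p" "\<And>i. U i \<inter> W = {}"
      and U0: "U 0 = {}" and mono: "mono U"
      and growth: "\<And>i. D * euler_prod (U i) < euler_prod (U (Suc i) - U i)"
    by (rule euler_prod_chain[OF W(1), where D = D]) (rule that)
  have U_gt: "p > P" if "p \<in> U i" for p i
  proof -
    have "prime p" "p \<notin> W"
      using U(2)[OF that] U(3)[of i] that by blast+
    then show ?thesis
      by (simp add: W_def)
  qed
  have U_not_dvd: "\<not> int p dvd x" if "p \<in> U i" "x \<noteq> 0" "\<bar>x\<bar> \<le> int P" for p i x
    using U_gt[OF that(1)] that(2,3) dvd_imp_le_int[of x "int p"] by linarith

  define V where "V = (\<lambda>i. U (Suc (\<rho> i)) - U (\<rho> i))"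
  have V_disjoint: "V i \<inter> V j = {}" if "i \<in> {1..k}" "j \<in> {1..k}" "i \<noteq> j" for i j
  proof -
    have "\<rho> i \<noteq> \<rho> j"
      using that by (auto simp: \<rho>_def)
    then have "Suc (\<rho> i) \<le> \<rho> j \<or> Suc (\<rho> j) \<le> \<rho> i"
      by auto
    then have "U (Suc (\<rho> i)) \<subseteq> U (\<rho> j) \<or> U (Suc (\<rho> j)) \<subseteq> U (\<rho> i)"
      using mono by (auto dest: monoD)
    then show ?thesis
      by (auto simp: V_def)
  qed
  define L where "L = nat (2 * \<bar>b\<bar> + \<bar>d\<bar> + 1)"
  obtain n0 where n0: "n0 \<ge> L"
      and n0_dvd: "\<And>i p. i \<in> {1..k} \<Longrightarrow> p \<in> V i \<Longrightarrow> int p dvd c * (int n0 + int i) + d"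
  proof (rule progression_dividing_forms[of "{1..k}" V c L "\<lambda>i. i" d])
    show "prime p \<and> \<not> int p dvd c" if "p \<in> V i" for i p
      using that U(2) U_not_dvd[of p _ c] P assms by (auto simp: V_def)
  qed (use U V_disjoint in \<open>auto simp: V_def\<close>)

  define Q where "Q = (\<Prod>p\<in>U k. p)"
  have "Q > 0"
    unfolding Q_def using U(2) by (intro prod_pos) (auto simp: prime_gt_0_nat)
  have dvd_Q: "p dvd Q" if "p \<in> U k" for p
    unfolding Q_def using that U(1) by (intro dvd_prodI) auto
  have prime_dvd_Q: "p \<in> U k" if "prime p" "p dvd Q" for p
  proof -
    have "\<exists>q\<in>U k. p dvd q"
      using that U(1)[of k] by (simp add: Q_def prime_dvd_prod_iff)
    then obtain q where q: "q \<in> U k" "p dvd q" ..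
    then have "p = q"
      using that(1) U(2)[OF q(1)] by (intro primes_dvd_imp_eq)
    then show ?thesis
      using q(1) by simp
  qed
  define \<alpha> where "\<alpha> = nat a * Q"
  define \<beta> where "\<beta> = (\<lambda>i. nat (a * (int n0 + int i) + b))"
  have n0_pos: "a * (int n0 + int i) + b > 0" for i
  proof -
    have "int n0 + int i \<le> a * (int n0 + int i)"
      using assms(1) by (simp add: mult_le_cancel_right1)
    then show ?thesis
      using n0 by (simp add: L_def)
  qed
  \<comment> \<open>Along \<open>n = n0 + Q * m\<close> the forms with leading coefficient \<open>a\<close> are progressions in \<open>m\<close>.\<close>
  have form: "nat (a * (int (n0 + Q * m) + int i) + b) = \<alpha> * m + \<beta> i" for m i
  proof -
    have "a * (int (n0 + Q * m) + int i) + b = a * (int Q * int m) + (a * (int n0 + int i) + b)"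
      by (simp add: algebra_simps)
    also have "\<dots> = int (\<alpha> * m + \<beta> i)"
      using n0_pos[of i] assms(1) by (simp add: \<alpha>_def \<beta>_def)
    finally show ?thesis
      by (simp only: nat_int)
  qed

  define bad where "bad = (\<lambda>X i. {m \<in> {1..X}. exp 2 <
      euler_prod {p \<in> prime_factors (\<alpha> * m + \<beta> i). P < p \<and> \<not> p dvd \<alpha>}})"
  have good: "n0 + Q * m \<in> ?S" if m: "m \<in> {1..X}" "\<And>i. i \<in> {1..k} \<Longrightarrow> m \<notin> bad X i" for m X
  proof -
    define n where "n = n0 + Q * m"
    have "n \<ge> L"
      using n0 by (simp add: n_def)
    then have "n > 0"
      by (simp add: L_def)
    have "a * (int n + int i) + b > 0 \<and> c * (int n + int i) + d > 0 \<and>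
        totient (nat (c * (int n + int i) + d)) < totient (nat (a * (int n + int i) + b))"
      if i: "i \<in> {1..k}" for i
    proof -
      define t where "t = int n + int i"
      have t: "t \<ge> 2 * \<bar>b\<bar> + \<bar>d\<bar> + 1"
        using \<open>n \<ge> L\<close> unfolding t_def L_def by linarith
      have at: "a * t \<ge> t" "c * t \<ge> t"
        using assms t by (auto simp: mult_le_cancel_right1)
      have pos: "a * t + b > 0" "c * t + d > 0"
        using at t by linarith+
      have "d \<le> \<bar>d\<bar> * t"
        using t mult_left_mono[of 1 t "\<bar>d\<bar>"] by linarith
      then have "c * t + d \<le> (c + \<bar>d\<bar>) * t"
        by (simp add: algebra_simps)
      also have "\<dots> \<le> (c + \<bar>d\<bar>) * (2 * (a * t + b))"
        using at(1) t assms(2) by (intro mult_left_mono) auto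
      finally have "real_of_int (c * t + d) \<le> real_of_int ((c + \<bar>d\<bar>) * (2 * (a * t + b)))"
        by (simp only: of_int_le_iff)
      then have ratio: "real (nat (c * t + d)) \<le> B * real (nat (a * t + b))"
        using pos by (simp add: B_def algebra_simps)

      have V_dvd: "int p dvd c * (int n + int j) + d" if "j \<in> {1..k}" "p \<in> V j" for p j
      proof -
        have "V j \<subseteq> U k"
        proof -
          have "Suc (\<rho> j) \<le> k"
            using that(1) by (auto simp: \<rho>_def)
          then show ?thesis
            using monoD[OF mono] by (auto simp: V_def)
        qed
        then have "int p dvd int Q"
          using dvd_Q that by auto
        then have "int p dvd (c * (int n0 + int j) + d) + c * int m * int Q"
          by (rule dvd_add[OF n0_dvd[OF that] dvd_mult])
        then show ?thesis
          by (simp add: n_def algebra_simps)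
      qed
      have VC: "V i \<subseteq> prime_factors (nat (c * t + d))"
      proof
        fix p assume "p \<in> V i"
        then have "prime p" "int p dvd c * t + d"
          using V_dvd[OF i] U(2) by (auto simp: V_def t_def)
        moreover have "p dvd nat (c * t + d)"
          using \<open>int p dvd c * t + d\<close> pos by (metis int_dvd_int_iff int_nat_eq less_imp_le)
        ultimately show "p \<in> prime_factors (nat (c * t + d))"
          using pos by (auto simp: in_prime_factors_iff)
      qed

      \<comment> \<open>The primes of \<open>?G\<close> are those controlled by the averaging argument.\<close>
      let ?G = "{p \<in> prime_factors (\<alpha> * m + \<beta> i). P < p \<and> \<not> p dvd \<alpha>}"
      have formA: "nat (a * t + b) = \<alpha> * m + \<beta> i"
        using form[of m i] by (simp add: t_def n_def)
      have "prime_factors (nat (a * t + b)) \<subseteq> (W \<union> U (\<rho> i)) \<union> ?G"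
      proof
        fix p assume p: "p \<in> prime_factors (nat (a * t + b))"
        then have pp: "prime p" and "p dvd nat (a * t + b)"
          by auto
        then have pA: "int p dvd a * t + b"
          using pos by (metis int_dvd_int_iff int_nat_eq less_imp_le)
        show "p \<in> (W \<union> U (\<rho> i)) \<union> ?G"
        proof (cases "p \<in> W \<or> p \<in> ?G")
          case False
          then have "P < p" "p dvd \<alpha>"
            using p pp formA by (auto simp: W_def)
          then have "p dvd nat a \<or> p dvd Q"
            using pp by (simp add: \<alpha>_def prime_dvd_mult_iff)
          moreover have "\<not> p dvd nat a"
            using \<open>P < p\<close> P(1) assms(1) dvd_imp_le[of p "nat a"] by auto
          ultimately have "p \<in> U k"
            using prime_dvd_Q pp by blast
          \<comment> \<open>Locate the index \<open>j\<close> with \<open>p \<in> V j\<close>: the first \<open>U r\<close> that contains \<open>p\<close> has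
            \<open>r = Suc r'\<close> with \<open>r' = \<rho> j\<close>.\<close>
          define r where "r = (LEAST r. p \<in> U r)"
          have r: "p \<in> U r" "r \<le> k"
            unfolding r_def using \<open>p \<in> U k\<close> by (auto intro: LeastI Least_le)
          have "r \<noteq> 0"
            using r U0 by (cases r) auto
          then obtain r' where r': "r = Suc r'"
            by (cases r) auto
          then have "p \<notin> U r'"
            using not_less_Least[of r' "\<lambda>r. p \<in> U r"] by (auto simp: r_def)
          define j where "j = (if a * d > b * c then Suc r' else k - r')"
          have j: "j \<in> {1..k}" "\<rho> j = r'"
            using r r' by (auto simp: j_def \<rho>_def)
          then have "p \<in> V j"
            using r r' \<open>p \<notin> U r'\<close> by (simp add: V_def)
          then have pC: "int p dvd c * (int n + int j) + d"
            using V_dvd j by blast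
          \<comment> \<open>The combination of the two forms that eliminates \<open>n\<close>.\<close>
          define z where "z = a * c * (int i - int j) + (b * c - a * d)"
          have "z = c * (a * t + b) - a * (c * (int n + int j) + d)"
            by (simp add: z_def t_def algebra_simps)
          then have "int p dvd z"
            using pA pC by auto
          moreover have "\<bar>z\<bar> \<le> int P"
          proof -
            have "\<bar>int i - int j\<bar> \<le> int k"
              using i j(1) by auto
            then have "\<bar>a * c * (int i - int j)\<bar> \<le> a * c * int k"
              using assms(1,2) by (simp add: abs_mult)
            then show ?thesis
              using P(3) by (simp add: z_def)
          qed
          ultimately have "z = 0"
            using U_not_dvd[OF r(1)] by blast
          then have "a * c * (int i - int j) = a * d - b * c"
            by (simp add: z_def)
          moreover have "0 < a * c"
            using assms(1,2) by simp
          ultimately have "b * c < a * d \<longleftrightarrow> j < i" "i \<noteq> j"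
            using assms(3) zero_less_mult_iff[of "a * c" "int i - int j"] by auto
          then have "\<rho> j < \<rho> i"
            using i j(1) by (auto simp: \<rho>_def)
          then have "Suc r' \<le> \<rho> i"
            using j by simp
          then have "p \<in> U (\<rho> i)"
            using r r' monoD[OF mono] by blast
          then show ?thesis
            by blast
        qed auto
      qed
      then have "euler_prod (prime_factors (nat (a * t + b))) \<le> euler_prod ((W \<union> U (\<rho> i)) \<union> ?G)"
        using W U by (intro euler_prod_mono) auto
      also have "\<dots> \<le> euler_prod (W \<union> U (\<rho> i)) * euler_prod ?G"
        using W U by (intro euler_prod_Un_le) auto
      also have "\<dots> \<le> (euler_prod W * euler_prod (U (\<rho> i))) * exp 2"
      proof (intro mult_mono)
        show "euler_prod (W \<union> U (\<rho> i)) \<le> euler_prod W * euler_prod (U (\<rho> i))"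
          using W U by (intro euler_prod_Un_le) auto
        show "euler_prod ?G \<le> exp 2"
          using m(1) m(2)[OF i] by (auto simp: bad_def)
        show "0 \<le> euler_prod W * euler_prod (U (\<rho> i))"
          using W U by (intro mult_nonneg_nonneg less_imp_le[OF euler_prod_pos]) auto
        show "0 \<le> euler_prod ?G"
          by (intro less_imp_le[OF euler_prod_pos]) auto
      qed
      finally have upper: "euler_prod (prime_factors (nat (a * t + b)))
          \<le> (euler_prod W * euler_prod (U (\<rho> i))) * exp 2" .
      have "totient (nat (c * t + d)) < totient (nat (a * t + b))"
      proof (rule totient_less_of_euler_prod_bounds[OF _ _ ratio upper])
        show "euler_prod (V i) \<le> euler_prod (prime_factors (nat (c * t + d)))"
          using VC by (intro euler_prod_mono) auto
        show "B * (euler_prod W * euler_prod (U (\<rho> i)) * exp 2) < euler_prod (V i)"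
          using growth[of "\<rho> i"] by (simp add: V_def D_def mult_ac)
      qed (use pos in auto)
      then show ?thesis
        using pos by (simp add: t_def)
    qed
    then show ?thesis
      using \<open>n > 0\<close> by (simp add: n_def)
  qed

  define X0 where "X0 = (\<Sum>i\<in>{1..k}. \<alpha> + \<beta> i) + 2"
  show ?thesis
  proof (rule lower_density_pos_of_progression[OF \<open>Q > 0\<close>])
    fix X assume X: "X \<ge> X0"
    have card_bad: "real (card (bad X i)) \<le> 2 * real X / real P" if "i \<in> {1..k}" for i
    proof -
      have "\<alpha> + \<beta> i \<le> (\<Sum>i\<in>{1..k}. \<alpha> + \<beta> i)"
        using that by (intro member_le_sum) auto
      then show ?thesis
        unfolding bad_def using X P(5) n0_pos[of i]
        by (intro card_large_euler_prod_le) (auto simp: X0_def \<beta>_def)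
    qed
    have fin: "finite (\<Union>i\<in>{1..k}. bad X i)"
      by (auto simp: bad_def)
    have "real (card (\<Union>i\<in>{1..k}. bad X i)) \<le> (\<Sum>i\<in>{1..k}. real (card (bad X i)))"
      using card_UN_le[of "{1..k}" "bad X"] by (simp flip: of_nat_sum)
    also have "\<dots> \<le> (\<Sum>i\<in>{1..k}. 2 * real X / real P)"
      using card_bad by (intro sum_mono)
    also have "\<dots> = real k * (2 * real X / real P)"
      by simp
    also have "\<dots> \<le> real X / 2"
    proof -
      have "4 * real k \<le> real P"
        using P(4) by linarith
      then have "4 * real k * real X \<le> real P * real X"
        by (intro mult_right_mono) auto
      then show ?thesis
        using P(5) by (simp add: field_simps)
    qed
    finally have few: "real (card (\<Union>i\<in>{1..k}. bad X i)) \<le> real X / 2" .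
    have "real X - real (card (\<Union>i\<in>{1..k}. bad X i)) \<le> real (card ({1..X} - (\<Union>i\<in>{1..k}. bad X i)))"
      using diff_card_le_card_Diff[OF fin, of "{1..X}"] by simp
    also have "\<dots> \<le> real (card {m \<in> {1..X}. n0 + Q * m \<in> ?S})"
      using good[of _ X] by (intro of_nat_mono card_mono) auto
    finally show "real X / 2 \<le> real (card {m \<in> {1..X}. n0 + Q * m \<in> ?S})"
      using few by simp
  qed
qed

end
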